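(* Let $\mathcal{M}\subset\mathbb{R}^{n\times n}$ be compact, convex and irreducible with $\rho(\mathcal{M})=0$, and let $v$ be a Barabanov norm. Let $x(\cdot)$ be an extremal solution of the switched system such that $x(0)=x_0$, associated with a switching law $\hat A(\cdot)$, and let $T\ge0$ and $\hat l\in\partial v(x(T))$. Then there exists a non-zero solution $l(\cdot)$ of the adjoint system $\dot l(t)=-\hat A^T(t)l(t)$ associated with $\hat A(\cdot)$ such that the following holds: $$l(t)\in\partial v(x(t))\quad\forall t\in[0,T],$$ $$\max_{A\in\mathcal{M}}l^T(t)Ax(t)=l^T(t)\hat A(t)x(t)=0\quad\text{for a.e. }t\in[0,T],$$ $$l(T)=\hat l.$$
   Context: A switching law is a measurable $A:[0,\infty)\to\mathcal{M}$; a solution of the switched system associated with it is an absolutely continuous $x:[0,\infty)\to\mathbb{R}^n$ with $\dot x(t)=A(t)x(t)$ a.e. $\mathcal{M}$ is irreducible if no nonzero proper subspace of $\mathbb{R}^n$ is invariant under all $A\in\mathcal{M}$. $\rho(\mathcal{M}):=\sup\limsup_{t\to+\infty}\frac1t\log\|x(t)\|$, where the supremum is over all solutions with $x(0)\ne0$ and all switching laws. A Barabanov norm is a norm $v$ on $\mathbb{R}^n$ such that (1) $v(x(t))\le v(x(0))$ for every solution $x(\cdot)$ and every $t\ge0$; (2) for every $y\in\mathbb{R}^n$ there is a solution $x(\cdot)$ with $x(0)=y$ and $v(x(t))=v(y)$ for all $t\ge0$. A solution $x(\cdot)$ is extremal if $v(x(t))=v(x(0))$ for all $t\ge0$. $\partial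 v(x)$ is the subdifferential of $v$ at $x$: the set of $l\in\mathbb{R}^n$ with $l^Tx=v(x)$ and $l^Ty\le v(y)$ for every $y\in\mathbb{R}^n$.
   Formalization: The formal theorem additionally assumes that l̂ is non-zero; this is automatic when x_0 ≠ 0, and for x_0 = 0 and l̂ = 0 the claim is false, because l(T) = 0 forces the adjoint solution l to vanish identically. *)

theory Defs
  imports "HOL-Analysis.Analysis"
begin

text \<open>
  Trajectories are total functions on \<^typ>\<open>real\<close>, but every notion below looks only at their
  values on \<open>[0, \<infinity>)\<close>. Measurability is Lebesgue measurability.
\<close>

definition switching_law :: "(real ^ 'n ^ 'n) set \<Rightarrow> (real \<Rightarrow> real ^ 'n ^ 'n) \<Rightarrow> bool" where
  "switching_law M A \<longleftrightarrow>
     A \<in> borel_measurable (lebesgue_on {0..}) \<and> (\<forall>t\<ge>0. A t \<in> M)"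

text \<open>
  The usual epsilon-delta definition; the elements of a division are nonempty compact intervals
  with disjoint interiors, so \<open>Inf K\<close> and \<open>Sup K\<close> are the endpoints of \<open>K\<close>.
\<close>

definition abs_continuous_on_interval ::
    "real \<Rightarrow> real \<Rightarrow> (real \<Rightarrow> 'a::real_normed_vector) \<Rightarrow> bool" where
  "abs_continuous_on_interval a b f \<longleftrightarrow>
     (\<forall>e>0. \<exists>d>0. \<forall>D S. D division_of S \<and> S \<subseteq> {a..b} \<and> (\<Sum>K\<in>D. Sup K - Inf K) < d
        \<longrightarrow> (\<Sum>K\<in>D. norm (f (Sup K) - f (Inf K))) < e)"

text \<open>
  Absolute continuity on \<open>[0, \<infinity>)\<close> is meant on each compact subinterval, as always for solutions
  of differential equations on a half-line: a uniform epsilon-delta condition on all of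
  \<open>[0, \<infinity>)\<close> would already exclude \<open>t \<mapsto> exp t\<close>.
\<close>

definition linear_solution :: "(real \<Rightarrow> real ^ 'n ^ 'n) \<Rightarrow> (real \<Rightarrow> real ^ 'n) \<Rightarrow> bool" where
  "linear_solution A x \<longleftrightarrow>
     (\<forall>b\<ge>0. abs_continuous_on_interval 0 b x) \<and>
     (AE t in lebesgue_on {0..}. (x has_vector_derivative A t *v x t) (at t within {0..}))"

definition switched_solution :: "(real ^ 'n ^ 'n) set \<Rightarrow> (real \<Rightarrow> real ^ 'n) \<Rightarrow> bool" where
  "switched_solution M x \<longleftrightarrow> (\<exists>A. switching_law M A \<and> linear_solution A x)"

definition adjoint_solution :: "(real \<Rightarrow> real ^ 'n ^ 'n) \<Rightarrow> (real \<Rightarrow> real ^ 'n) \<Rightarrow> bool" where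
  "adjoint_solution A l \<longleftrightarrow> linear_solution (\<lambda>t. - transpose (A t)) l"

definition irreducible_matrices :: "(real ^ 'n ^ 'n) set \<Rightarrow> bool" where
  "irreducible_matrices M \<longleftrightarrow>
     \<not> (\<exists>V. subspace V \<and> V \<noteq> {0} \<and> V \<noteq> UNIV \<and> (\<forall>A\<in>M. \<forall>y\<in>V. A *v y \<in> V))"

text \<open>
  A solution with \<open>x 0 \<noteq> 0\<close> never vanishes, so \<^const>\<open>ln\<close> is only taken at positive arguments.
\<close>

definition max_lyapunov_exponent :: "(real ^ 'n ^ 'n) set \<Rightarrow> ereal" where
  "max_lyapunov_exponent M =
     (SUP x \<in> {x. switched_solution M x \<and> x 0 \<noteq> 0}.
        Limsup at_top (\<lambda>t. ereal (1 / t * ln (norm (x t)))))"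

definition is_norm :: "('a::real_vector \<Rightarrow> real) \<Rightarrow> bool" where
  "is_norm v \<longleftrightarrow>
     (\<forall>x. 0 \<le> v x) \<and> (\<forall>x. v x = 0 \<longleftrightarrow> x = 0) \<and>
     (\<forall>c x. v (c *\<^sub>R x) = \<bar>c\<bar> * v x) \<and> (\<forall>x y. v (x + y) \<le> v x + v y)"

definition barabanov_norm :: "(real ^ 'n ^ 'n) set \<Rightarrow> (real ^ 'n \<Rightarrow> real) \<Rightarrow> bool" where
  "barabanov_norm M v \<longleftrightarrow>
     is_norm v \<and>
     (\<forall>x. switched_solution M x \<longrightarrow> (\<forall>t\<ge>0. v (x t) \<le> v (x 0))) \<and>
     (\<forall>y. \<exists>x. switched_solution M x \<and> x 0 = y \<and> (\<forall>t\<ge>0. v (x t) = v y))"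

definition extremal_solution ::
    "(real ^ 'n ^ 'n) set \<Rightarrow> (real ^ 'n \<Rightarrow> real) \<Rightarrow> (real \<Rightarrow> real ^ 'n) \<Rightarrow> bool" where
  "extremal_solution M v x \<longleftrightarrow> switched_solution M x \<and> (\<forall>t\<ge>0. v (x t) = v (x 0))"

text \<open>
  At \<open>x = 0\<close> this is the whole dual unit ball of \<open>v\<close>; in particular it contains \<open>0\<close> there, and
  only there.
\<close>

definition subdifferential :: "(real ^ 'n \<Rightarrow> real) \<Rightarrow> real ^ 'n \<Rightarrow> (real ^ 'n) set" where
  "subdifferential v x = {l. l \<bullet> x = v x \<and> (\<forall>y. l \<bullet> y \<le> v y)}"

end

theory Submission
  imports Defs
begin

text \<open>
  Let \<open>l\<close> be the adjoint solution with \<open>l T = lhat\<close>. Pairings of adjoint solutions with solutions \<open>z\<close>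
  of the system for \<open>Ahat\<close> are constant in time, so if \<open>z t = y\<close> then
  \<open>l t \<bullet> y = lhat \<bullet> z T \<le> v (z T) \<le> v y\<close>, with equality for \<open>z = x\<close>: thus \<open>l t\<close> is a subgradient at
  \<open>x t\<close>. Along the solution \<open>w\<close> with constant switching law \<open>A\<close> starting at \<open>x t\<close> we get
  \<open>l t \<bullet> w s \<le> v (w s) \<le> v (x t) = l t \<bullet> w 0\<close>, whose derivative at \<open>s = 0\<close> is \<open>l t \<bullet> A x t \<le> 0\<close>. Finally
  \<open>s \<mapsto> l t \<bullet> x s\<close> is maximal at \<open>s = t\<close>, so its derivative \<open>l t \<bullet> Ahat t x t\<close> vanishes.
\<close>

section \<open>Lebesgue differentiation on the line\<close>

text \<open>Finite subunions obey the bound by subadditivity, and the measure of a countable union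
  is the supremum over them. This passes from finite disjoint families, which Henstock's lemma
  controls, to the whole countable Vitali subfamily.\<close>

lemma measure_countable_Union_le_sum:
  fixes g :: "'a \<Rightarrow> 'b::euclidean_space set"
  assumes "countable C" and "\<And>i. i \<in> C \<Longrightarrow> g i \<in> lmeasurable"
    and "\<And>D. \<lbrakk>D \<subseteq> C; finite D\<rbrakk> \<Longrightarrow> (\<Sum>i\<in>D. measure lebesgue (g i)) \<le> B"
  shows "\<Union>(g ` C) \<in> lmeasurable" "measure lebesgue (\<Union>(g ` C)) \<le> B"
proof -
  have *: "measure lebesgue (\<Union>\<D>) \<le> B" if \<D>: "\<D> \<subseteq> g ` C" "finite \<D>" for \<D>
  proof -
    obtain D where D: "D \<subseteq> C" "finite D" "\<D> = g ` D"
      using finite_subset_image[OF \<D>(2,1)] by blast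
    have "measure lebesgue (\<Union>\<D>) \<le> (\<Sum>i\<in>D. measure lebesgue (g i))"
      unfolding D(3) using D assms(2) by (intro measure_UNION_le) auto
    with assms(3)[OF D(1,2)] show ?thesis by linarith
  qed
  have **: "countable (g ` C)" "\<And>d. d \<in> g ` C \<Longrightarrow> d \<in> lmeasurable"
    using assms by auto
  show "\<Union>(g ` C) \<in> lmeasurable" "measure lebesgue (\<Union>(g ` C)) \<le> B"
    using fmeasurable_Union_bound[OF ** *] measure_Union_bound[OF ** *] by auto
qed

text \<open>The intervals witnessing a bad difference quotient form a Vitali cover, and Henstock's
  lemma bounds the total length of disjoint families of them.\<close>

lemma negligible_bad_difference_quotients:
  fixes f :: "real \<Rightarrow> 'b::euclidean_space"
  assumes f: "f integrable_on {a..b}" and "0 < e"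
  defines "F \<equiv> \<lambda>s. integral {a..s} f"
  shows "negligible {t\<in>{a<..<b}. \<forall>d>0. \<exists>w\<in>{a<..<b}. w \<noteq> t \<and> \<bar>w - t\<bar> < d \<and>
           e * \<bar>w - t\<bar> < norm (F w - F t - (w - t) *\<^sub>R f t)}"
    (is "negligible ?S")
  unfolding negligible_outer_le
proof (intro allI impI)
  fix \<eta> :: real assume "0 < \<eta>"
  \<comment> \<open>A bad interval contributes at least \<open>e\<close> times its length to the
    Henstock sum, so the bound \<open>e * \<eta>\<close> on that sum leaves at most
    \<open>\<eta>\<close> for the total length.\<close>
  then have "0 < e * \<eta>" using \<open>0 < e\<close> by simp
  then obtain \<gamma> where "gauge \<gamma>" and \<gamma>: "\<And>p. \<lbrakk>p tagged_partial_division_of (cbox a b); \<gamma> fine p\<rbrakk> \<Longrightarrow>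
             sum (\<lambda>(x,k). norm(measure lborel k *\<^sub>R f x - integral k f)) p < e * \<eta>"
    using Henstock_lemma[of f a b "e * \<eta>"] f by auto
  \<comment> \<open>An index \<open>(t, w)\<close> keeps the tag \<open>t\<close> as an endpoint of
    its interval. Midpoint and half-length exhibit the interval as a closed ball, the form in which
    Vitali's covering theorem is applied.\<close>
  define I where "I = (\<lambda>(t::real, w). {min t w..max t w})"
  define m where "m = (\<lambda>(t::real, w::real). (t + w) / 2)"
  define r where "r = (\<lambda>(t::real, w::real). \<bar>w - t\<bar> / 2)"
  have I: "cball (m i) (r i) = I i" for i
    by (auto simp: I_def m_def r_def cball_eq_atLeastAtMost split: prod.splits)
       (auto simp: min_def max_def abs_if field_simps split: if_splits)
  \<comment> \<open>Requiring \<open>I (t, w) \<subseteq> \<gamma> t\<close> makes every selected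
    family automatically \<open>\<gamma>\<close>-fine.\<close>
  define K where "K = {(t, w). t \<in> {a<..<b} \<and> w \<in> {a<..<b} \<and> w \<noteq> t \<and> I (t, w) \<subseteq> \<gamma> t \<and>
      e * \<bar>w - t\<bar> < norm (F w - F t - (w - t) *\<^sub>R f t)}"
  have cover: "\<exists>i. i \<in> K \<and> t \<in> I i \<and> r i < d" if t: "t \<in> ?S" and "0 < d" for t d
  proof -
    from \<open>gauge \<gamma>\<close> have "open (\<gamma> t)" "t \<in> \<gamma> t" by (auto simp: gauge_def)
    then obtain d' where d': "0 < d'" "ball t d' \<subseteq> \<gamma> t" by (meson open_contains_ball)
    with t \<open>0 < d\<close> obtain w where w: "w \<in> {a<..<b}" "w \<noteq> t" "\<bar>w - t\<bar> < min d d'"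
      "e * \<bar>w - t\<bar> < norm (F w - F t - (w - t) *\<^sub>R f t)"
      by (auto dest!: spec[of _ "min d d'"])
    have "I (t, w) \<subseteq> ball t d'" using w(3)
      by (auto simp: I_def dist_real_def)
    with w d' t have "(t, w) \<in> K" by (auto simp: K_def)
    moreover have "t \<in> I (t, w)" by (auto simp: I_def)
    moreover have "r (t, w) < d" using w(3) \<open>0 < d\<close> by (auto simp: r_def)
    ultimately show ?thesis by blast
  qed
  have r: "0 < r i" if "i \<in> K" for i using that by (auto simp: K_def r_def)
  obtain C where C: "countable C" "C \<subseteq> K"
     "pairwise (\<lambda>i j. disjnt (I i) (I j)) C" "negligible (?S - (\<Union>i \<in> C. I i))"
    by (rule Vitali_covering_theorem_cballs[of K r ?S m, unfolded I, OF r cover])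
  have sum: "(\<Sum>i\<in>D. measure lebesgue (I i)) \<le> \<eta>" if D: "D \<subseteq> C" "finite D" for D
  proof -
    define p where "p = (\<lambda>i. (fst i, I i)) ` D"
    have DK: "i \<in> K" if "i \<in> D" for i using that D C by auto
    have ne: "fst i \<in> I i" for i by (auto simp: I_def split: prod.splits)
    \<comment> \<open>Intervals of distinct selected indices are disjoint and nonempty, hence
      different, so sums over \<open>p\<close> can be reindexed by \<open>D\<close>.\<close>
    have inj: "inj_on (\<lambda>i. (fst i, I i)) D"
    proof (rule inj_onI)
      fix i j assume ij: "i \<in> D" "j \<in> D" "(fst i, I i) = (fst j, I j)"
      then have "\<not> disjnt (I i) (I j)" using ne[of i] by (auto simp: disjnt_def)
      with ij(1,2) D(1) show "i = j" using pairwiseD[OF C(3)] by blast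
    qed
    have "p tagged_partial_division_of (cbox a b)"
      unfolding tagged_partial_division_of_def
    proof (intro conjI allI impI)
      show "finite p" using D by (simp add: p_def)
      fix x k assume xk: "(x, k) \<in> p"
      then obtain i where i: "i \<in> D" "x = fst i" "k = I i" by (auto simp: p_def)
      show "x \<in> k" using i ne by auto
      show "k \<subseteq> cbox a b" using DK[OF i(1)] i by (auto simp: K_def I_def)
      show "\<exists>a b. k = cbox a b" using i by (auto simp: I_def split: prod.splits)
    next
      fix x k x' k' assume "(x, k) \<in> p \<and> (x', k') \<in> p \<and> (x, k) \<noteq> (x', k')"
      then obtain i j where ij: "i \<in> D" "j \<in> D" "k = I i" "k' = I j" "i \<noteq> j"
        by (auto simp: p_def)
      then have "disjnt k k'" using pairwiseD[OF C(3)] D(1) by blast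
      then show "interior k \<inter> interior k' = {}"
        using interior_subset by (auto simp: disjnt_def)
    qed
    moreover have "\<gamma> fine p"
      using DK by (force simp: fine_def p_def K_def)
    ultimately have "(\<Sum>(x,k)\<in>p. norm (measure lborel k *\<^sub>R f x - integral k f)) < e * \<eta>"
      by (rule \<gamma>)
    also have "(\<Sum>(x,k)\<in>p. norm (measure lborel k *\<^sub>R f x - integral k f)) =
        (\<Sum>i\<in>D. norm (measure lborel (I i) *\<^sub>R f (fst i) - integral (I i) f))"
      unfolding p_def by (subst sum.reindex[OF inj]) simp
    finally have lt: "(\<Sum>i\<in>D. norm (measure lborel (I i) *\<^sub>R f (fst i) - integral (I i) f)) < e * \<eta>" .
    \<comment> \<open>The increment of \<open>F\<close> is the integral over \<open>I i\<close> up
      to sign; the sign depends on which side of \<open>t\<close> the point \<open>w\<close> lies,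
      and the norm removes it.\<close>
    have "e * measure lebesgue (I i) \<le> norm (measure lborel (I i) *\<^sub>R f (fst i) - integral (I i) f)"
      if "i \<in> D" for i
    proof -
      obtain t w where i: "i = (t, w)" by force
      have k: "t \<in> {a<..<b}" "w \<in> {a<..<b}"
        "e * \<bar>w - t\<bar> < norm (F w - F t - (w - t) *\<^sub>R f t)"
        using DK[OF that] i by (auto simp: K_def)
      have comb: "F v = F u + integral {u..v} f" if "u \<le> v" "u \<in> {a<..<b}" "v \<in> {a<..<b}" for u v
        unfolding F_def using that
        by (intro Henstock_Kurzweil_Integration.integral_combine[symmetric])
           (auto intro: integrable_on_subinterval[OF f])
      show ?thesis
      proof (cases "t \<le> w")
        case True
        then have "I i = {t..w}" by (auto simp: I_def i)
        with comb[OF True k(1,2)] True k(3) show ?thesis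
          by (simp add: i norm_minus_commute)
      next
        case False
        then have "I i = {w..t}" by (auto simp: I_def i)
        moreover have "F w - F t - (w - t) *\<^sub>R f t = (t - w) *\<^sub>R f t - integral {w..t} f"
          using comb[of w t] False k(1,2) by (simp add: algebra_simps)
        ultimately show ?thesis
          using False k(3) by (simp add: i)
      qed
    qed
    then have "e * (\<Sum>i\<in>D. measure lebesgue (I i)) \<le> e * \<eta>"
      unfolding sum_distrib_left using lt by (meson less_imp_le order_trans sum_mono)
    then show ?thesis using \<open>0 < e\<close> by simp
  qed
  have U: "\<Union>(I ` C) \<in> lmeasurable" "measure lebesgue (\<Union>(I ` C)) \<le> \<eta>"
    using measure_countable_Union_le_sum[OF C(1), of I \<eta>] sum by (auto simp: I_def split: prod.splits)
  \<comment> \<open>The selected intervals have total measure at most \<open>\<eta>\<close>, and the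
    points of the bad set that they miss are null by Vitali.\<close>
  let ?T = "\<Union>(I ` C) \<union> (?S - (\<Union>i \<in> C. I i))"
  have "?T \<in> lmeasurable" using U(1) negligible_imp_measurable[OF C(4)] by (rule fmeasurable.Un)
  moreover have "measure lebesgue ?T \<le> \<eta>"
    using measure_Un_le[of "\<Union>(I ` C)" lebesgue "?S - (\<Union>i \<in> C. I i)"] U
      negligible_imp_measure0[OF C(4)] negligible_imp_measurable[OF C(4)]
    by (auto simp: fmeasurableD)
  ultimately show "\<exists>T. ?S \<subseteq> T \<and> T \<in> lmeasurable \<and> measure lebesgue T \<le> \<eta>"
    by (intro exI[of _ ?T]) blast
qed

text \<open>If the derivative fails at \<open>t\<close>, some tolerance \<open>1 / Suc n\<close> is
  violated arbitrarily close to \<open>t\<close>. The exceptional set is thus inside a countable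
  union of the null sets of bad difference quotients.\<close>

theorem lebesgue_differentiation:
  fixes f :: "real \<Rightarrow> 'b::euclidean_space"
  assumes f: "f integrable_on {a..b}"
  shows "negligible {t\<in>{a<..<b}. \<not> ((\<lambda>s. integral {a..s} f) has_vector_derivative f t) (at t)}"
proof -
  let ?F = "\<lambda>s. integral {a..s} f"
  define S where "S e = {t\<in>{a<..<b}. \<forall>d>0. \<exists>w\<in>{a<..<b}. w \<noteq> t \<and> \<bar>w - t\<bar> < d \<and>
           e * \<bar>w - t\<bar> < norm (?F w - ?F t - (w - t) *\<^sub>R f t)}" for e
  have neg: "negligible (\<Union>n. S (1 / Suc n))"
    unfolding S_def by (intro negligible_Union_nat negligible_bad_difference_quotients f) auto
  have deriv: "(?F has_vector_derivative f t) (at t)"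
    if t: "t \<in> {a<..<b}" "\<And>n. t \<notin> S (1 / Suc n)" for t
    unfolding has_vector_derivative_def has_derivative_at_alt
  proof (intro conjI allI impI)
    show "bounded_linear (\<lambda>x. x *\<^sub>R f t)" by (rule bounded_linear_scaleR_left)
    fix e :: real assume "0 < e"
    then obtain n where n: "1 / Suc n < e" using nat_approx_posE by blast
    have "\<not> (\<forall>d>0. \<exists>w\<in>{a<..<b}. w \<noteq> t \<and> \<bar>w - t\<bar> < d \<and>
           1 / Suc n * \<bar>w - t\<bar> < norm (?F w - ?F t - (w - t) *\<^sub>R f t))"
      using t(2)[of n] t(1) unfolding S_def by blast
    then obtain d where d: "0 < d" and nd: "\<not> (\<exists>w\<in>{a<..<b}. w \<noteq> t \<and> \<bar>w - t\<bar> < d \<and>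
           1 / Suc n * \<bar>w - t\<bar> < norm (?F w - ?F t - (w - t) *\<^sub>R f t))"
      by blast
    \<comment> \<open>The distances of \<open>t\<close> to both endpoints enter the radius so that
      \<open>w\<close> stays in the open interval where the quotients are controlled.\<close>
    have "norm (?F w - ?F t - (w - t) *\<^sub>R f t) \<le> e * norm (w - t)"
      if "norm (w - t) < min d (min (t - a) (b - t))" for w
    proof (cases "w = t")
      case False
      have "norm (?F w - ?F t - (w - t) *\<^sub>R f t) \<le> 1 / Suc n * \<bar>w - t\<bar>"
        using nd that False by (force simp: not_less)
      also have "\<dots> \<le> e * \<bar>w - t\<bar>" using n by (intro mult_right_mono) auto
      finally show ?thesis by simp
    qed simp
    then show "\<exists>d>0. \<forall>y. norm (y - t) < d \<longrightarrow> norm (?F y - ?F t - (y - t) *\<^sub>R f t) \<le> e * norm (y - t)"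
      using d t(1) by (intro exI[of _ "min d (min (t - a) (b - t))"]) auto
  qed
  show ?thesis
    by (rule negligible_subset[OF neg]) (use deriv in blast)
qed

section \<open>Absolutely continuous functions\<close>

lemma abs_continuous_on_interval_dist:
  assumes "abs_continuous_on_interval a b f" "0 < e"
  obtains d where "0 < d" "\<And>s t. \<lbrakk>s \<in> {a..b}; t \<in> {a..b}; \<bar>t - s\<bar> < d\<rbrakk> \<Longrightarrow> norm (f t - f s) < e"
proof -
  obtain d where d: "0 < d" "\<And>D S. D division_of S \<Longrightarrow> S \<subseteq> {a..b} \<Longrightarrow> (\<Sum>K\<in>D. Sup K - Inf K) < d
        \<Longrightarrow> (\<Sum>K\<in>D. norm (f (Sup K) - f (Inf K))) < e"
    using assms unfolding abs_continuous_on_interval_def by meson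
  \<comment> \<open>The division with the single element \<open>{s..t}\<close> suffices; it is
    nonempty even if \<open>s = t\<close>.\<close>
  have *: "norm (f t - f s) < e" if "s \<in> {a..b}" "t \<in> {a..b}" "\<bar>t - s\<bar> < d" "s \<le> t" for s t
    using d(2)[of "{{s..t}}" "{s..t}"] that division_of_self[of s t] by simp
  have "norm (f t - f s) < e" if "s \<in> {a..b}" "t \<in> {a..b}" "\<bar>t - s\<bar> < d" for s t
    using *[of s t] *[of t s] that by (cases "s \<le> t") (auto simp: norm_minus_commute abs_minus_commute)
  with d(1) show thesis by (rule that)
qed

lemma abs_continuous_on_interval_imp_continuous_on:
  assumes "abs_continuous_on_interval a b f"
  shows "continuous_on {a..b} f"
  unfolding continuous_on_iff
proof (intro ballI allI impI)
  fix t and e :: real assume "t \<in> {a..b}" "0 < e"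
  with abs_continuous_on_interval_dist[OF assms \<open>0 < e\<close>]
  show "\<exists>d>0. \<forall>s\<in>{a..b}. dist s t < d \<longrightarrow> dist (f s) (f t) < e"
    unfolding dist_norm real_norm_def by metis
qed

lemma division_of_subset_Icc_elem:
  fixes a b :: real
  assumes "D division_of S" "S \<subseteq> {a..b}" "K \<in> D"
  obtains u v where "K = {u..v}" "u \<le> v" "a \<le> u" "v \<le> b"
proof -
  obtain u v where K: "K = {u..v}" using division_ofD(4)[OF assms(1,3)] by (metis interval_cbox)
  moreover have "K \<noteq> {}" "K \<subseteq> {a..b}" using division_ofD(2,3)[OF assms(1,3)] assms(2) by auto
  ultimately show thesis by (intro that[of u v]) auto
qed

lemma lipschitz_imp_abs_continuous_on_interval:
  assumes "\<And>s t. \<lbrakk>a \<le> s; s \<le> t; t \<le> b\<rbrakk> \<Longrightarrow> norm (f t - f s) \<le> L * (t - s)"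
  shows "abs_continuous_on_interval a b f"
  unfolding abs_continuous_on_interval_def
proof (intro allI impI)
  fix e :: real assume "0 < e"
  \<comment> \<open>The maximum with \<open>1\<close> makes \<open>e / L'\<close> positive even when
    \<open>L\<close> is not.\<close>
  define L' where "L' = max L 1"
  have "(\<Sum>K\<in>D. norm (f (Sup K) - f (Inf K))) < e"
    if D: "D division_of S" "S \<subseteq> {a..b}" and lt: "(\<Sum>K\<in>D. Sup K - Inf K) < e / L'" for D S
  proof -
    have "norm (f (Sup K) - f (Inf K)) \<le> L' * (Sup K - Inf K)" if "K \<in> D" for K
    proof -
      obtain u v where K: "K = {u..v}" and uv: "u \<le> v" "a \<le> u" "v \<le> b"
        using division_of_subset_Icc_elem[OF D \<open>K \<in> D\<close>] .
      have "norm (f v - f u) \<le> L * (v - u)" using uv by (intro assms) auto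
      also have "\<dots> \<le> L' * (v - u)" using uv by (intro mult_right_mono) (auto simp: L'_def)
      finally show ?thesis using K uv by simp
    qed
    then have "(\<Sum>K\<in>D. norm (f (Sup K) - f (Inf K))) \<le> L' * (\<Sum>K\<in>D. Sup K - Inf K)"
      unfolding sum_distrib_left by (rule sum_mono)
    also have "\<dots> < e" using lt by (simp add: L'_def field_simps)
    finally show ?thesis .
  qed
  moreover have "0 < e / L'" using \<open>0 < e\<close> by (simp add: L'_def)
  ultimately show "\<exists>d>0. \<forall>D S. D division_of S \<and> S \<subseteq> {a..b} \<and> (\<Sum>K\<in>D. Sup K - Inf K) < d
        \<longrightarrow> (\<Sum>K\<in>D. norm (f (Sup K) - f (Inf K))) < e"
    by blast
qed

lemma abs_continuous_on_interval_inner: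
  fixes f g :: "real \<Rightarrow> 'a::real_inner"
  assumes f: "abs_continuous_on_interval a b f" and g: "abs_continuous_on_interval a b g"
  shows "abs_continuous_on_interval a b (\<lambda>t. f t \<bullet> g t)"
  unfolding abs_continuous_on_interval_def
proof (intro allI impI)
  fix e :: real assume "0 < e"
  have "bounded (f ` {a..b})" "bounded (g ` {a..b})"
    by (intro compact_imp_bounded compact_continuous_image compact_Icc
        abs_continuous_on_interval_imp_continuous_on f g)+
  then obtain C where C: "0 < C" "\<And>t. t \<in> {a..b} \<Longrightarrow> norm (f t) \<le> C" "\<And>t. t \<in> {a..b} \<Longrightarrow> norm (g t) \<le> C"
    using bounded_Un[of "f ` {a..b}" "g ` {a..b}"] unfolding bounded_pos by (auto simp: ball_Un)
  \<comment> \<open>Both factors are bounded by \<open>C\<close>, so each variation sum enters the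
    product estimate with weight \<open>C\<close> and may use up half of \<open>e\<close>.\<close>
  let ?e = "e / (2 * C)"
  have "0 < ?e" using \<open>0 < e\<close> C by simp
  obtain d1 where d1: "0 < d1" "\<And>D S. D division_of S \<Longrightarrow> S \<subseteq> {a..b} \<Longrightarrow> (\<Sum>K\<in>D. Sup K - Inf K) < d1
        \<Longrightarrow> (\<Sum>K\<in>D. norm (f (Sup K) - f (Inf K))) < ?e"
    using f \<open>0 < ?e\<close> unfolding abs_continuous_on_interval_def by meson
  obtain d2 where d2: "0 < d2" "\<And>D S. D division_of S \<Longrightarrow> S \<subseteq> {a..b} \<Longrightarrow> (\<Sum>K\<in>D. Sup K - Inf K) < d2
        \<Longrightarrow> (\<Sum>K\<in>D. norm (g (Sup K) - g (Inf K))) < ?e"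
    using g \<open>0 < ?e\<close> unfolding abs_continuous_on_interval_def by meson
  have "(\<Sum>K\<in>D. norm (f (Sup K) \<bullet> g (Sup K) - f (Inf K) \<bullet> g (Inf K))) < e"
    if D: "D division_of S" "S \<subseteq> {a..b}" and lt: "(\<Sum>K\<in>D. Sup K - Inf K) < min d1 d2" for D S
  proof -
    have "norm (f (Sup K) \<bullet> g (Sup K) - f (Inf K) \<bullet> g (Inf K)) \<le>
        C * (norm (f (Sup K) - f (Inf K)) + norm (g (Sup K) - g (Inf K)))" if "K \<in> D" for K
    proof -
      obtain u v where K: "K = {u..v}" and uv: "u \<le> v" "a \<le> u" "v \<le> b"
        using division_of_subset_Icc_elem[OF D \<open>K \<in> D\<close>] .
      have "f v \<bullet> g v - f u \<bullet> g u = (f v - f u) \<bullet> g v + f u \<bullet> (g v - g u)"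
        by (simp add: inner_diff_left inner_diff_right)
      also have "norm \<dots> \<le> norm (f v - f u) * norm (g v) + norm (f u) * norm (g v - g u)"
        by (intro norm_triangle_le add_mono) (auto simp: Cauchy_Schwarz_ineq2)
      also have "\<dots> \<le> norm (f v - f u) * C + C * norm (g v - g u)"
        using C uv by (intro add_mono mult_left_mono mult_right_mono) auto
      finally show ?thesis using K uv by (simp add: algebra_simps)
    qed
    then have "(\<Sum>K\<in>D. norm (f (Sup K) \<bullet> g (Sup K) - f (Inf K) \<bullet> g (Inf K))) \<le>
        C * ((\<Sum>K\<in>D. norm (f (Sup K) - f (Inf K))) + (\<Sum>K\<in>D. norm (g (Sup K) - g (Inf K))))"
      unfolding sum_distrib_left sum.distrib[symmetric] by (rule sum_mono)
    also have "\<dots> < C * (?e + ?e)"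
      using d1(2)[OF D] d2(2)[OF D] lt C(1) by (intro mult_strict_left_mono add_strict_mono) auto
    finally show ?thesis using C(1) by simp
  qed
  with d1(1) d2(1) show "\<exists>d>0. \<forall>D S. D division_of S \<and> S \<subseteq> {a..b} \<and> (\<Sum>K\<in>D. Sup K - Inf K) < d
        \<longrightarrow> (\<Sum>K\<in>D. norm (f (Sup K) \<bullet> g (Sup K) - f (Inf K) \<bullet> g (Inf K))) < e"
    by (intro exI[of _ "min d1 d2"]) auto
qed

text \<open>Cousin's lemma with a gauge that confines the intervals tagged in the exceptional set to an
  open set of small measure, where absolute continuity applies.\<close>

theorem abs_continuous_zero_derivative_imp_constant:
  fixes f :: "real \<Rightarrow> 'a::real_normed_vector"
  assumes f: "abs_continuous_on_interval a b f" and "a \<le> b" and E: "negligible E"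
    and deriv: "\<And>t. t \<in> {a..b} - E \<Longrightarrow> (f has_vector_derivative 0) (at t within {a..b})"
  shows "f b = f a"
proof -
  have "norm (f b - f a) \<le> 0 + e" if "0 < e" for e
  proof -
    \<comment> \<open>The tags in \<open>E\<close> cost at most \<open>\<epsilon>\<close> and the
      others at most \<open>\<epsilon> * (b - a)\<close>. The denominator stays positive when
      \<open>a = b\<close>.\<close>
    define \<epsilon> where "\<epsilon> = e / (2 + (b - a))"
    have "0 < \<epsilon>" using \<open>0 < e\<close> \<open>a \<le> b\<close> by (simp add: \<epsilon>_def)
    obtain d where d: "0 < d" "\<And>D S. D division_of S \<Longrightarrow> S \<subseteq> {a..b} \<Longrightarrow> (\<Sum>K\<in>D. Sup K - Inf K) < d
        \<Longrightarrow> (\<Sum>K\<in>D. norm (f (Sup K) - f (Inf K))) < \<epsilon>"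
      using f \<open>0 < \<epsilon>\<close> unfolding abs_continuous_on_interval_def by meson
    \<comment> \<open>Outer regularity: as \<open>E\<close> is null, the measure of \<open>U\<close>
      itself is below \<open>d\<close>.\<close>
    obtain U where U: "open U" "E \<subseteq> U" "U - E \<in> lmeasurable" "emeasure lebesgue (U - E) < ennreal d"
      using sets_lebesgue_outer_open[OF negligible_imp_sets[OF E] d(1)] by blast
    have Um: "U \<in> lmeasurable" "measure lebesgue U < d"
    proof -
      have "U = E \<union> (U - E)" using U(2) by auto
      then show "U \<in> lmeasurable"
        using fmeasurable.Un[OF negligible_imp_measurable[OF E] U(3)] by simp
      have "measure lebesgue U = measure lebesgue (U - E)"
        using \<open>U \<in> lmeasurable\<close> E by (simp add: measure_Diff_null_set negligible_iff_null_sets fmeasurableD)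
      also have "\<dots> < d"
        using U(3,4) d(1) by (simp add: emeasure_eq_measure2 ennreal_less_iff)
      finally show "measure lebesgue U < d" .
    qed
    have "\<exists>r>0. t \<in> {a..b} - E \<longrightarrow> (\<forall>s\<in>{a..b}. \<bar>s - t\<bar> < r \<longrightarrow> norm (f s - f t) \<le> \<epsilon> * \<bar>s - t\<bar>)" for t
    proof (cases "t \<in> {a..b} - E")
      case True
      with deriv[OF True] \<open>0 < \<epsilon>\<close> show ?thesis
        unfolding has_vector_derivative_def has_derivative_within_alt by simp
    qed (auto intro: exI[of _ 1])
    then obtain r where r: "\<And>t. 0 < r t"
      "\<And>t s. \<lbrakk>t \<in> {a..b} - E; s \<in> {a..b}; \<bar>s - t\<bar> < r t\<rbrakk> \<Longrightarrow> norm (f s - f t) \<le> \<epsilon> * \<bar>s - t\<bar>"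
      by metis
    define \<gamma> where "\<gamma> t = (if t \<in> E then U else ball t (r t))" for t
    have "gauge \<gamma>" using U(1,2) r(1) by (auto simp: gauge_def \<gamma>_def)
    then obtain p where p: "p tagged_division_of {a..b}" "\<gamma> fine p"
      using fine_division_exists_real by blast
    note pD = tagged_division_ofD[OF p(1)]
    let ?\<Delta> = "\<lambda>(x::real, K). f (Sup K) - f (Inf K)"
    define q where "q = {(x, K) \<in> p. x \<in> E}"
    have "q \<subseteq> p" by (auto simp: q_def)
    have pK: "\<exists>u v. K = {u..v} \<and> u \<le> v \<and> x \<in> {u..v} \<and> {u..v} \<subseteq> {a..b}" if xK: "(x, K) \<in> p" for x K
    proof -
      obtain u v where "K = {u..v}" using pD(4)[OF xK] by (metis interval_cbox)
      with pD(2,3)[OF xK] show ?thesis by auto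
    qed
    have q: "q tagged_division_of \<Union>(snd ` q)"
      using p(1) \<open>q \<subseteq> p\<close>
      by (meson tagged_division_of_def tagged_partial_division_of_Union_self tagged_partial_division_subset)
    have qd: "snd ` q division_of \<Union>(snd ` q)"
      using division_of_tagged_division[OF q] .
    have "(\<Sum>K\<in>snd ` q. Sup K - Inf K) = (\<Sum>K\<in>snd ` q. measure lebesgue K)"
    proof (rule sum.cong[OF refl])
      fix K assume "K \<in> snd ` q"
      then obtain x where "(x, K) \<in> p" using \<open>q \<subseteq> p\<close> by auto
      with pK[of x K] show "Sup K - Inf K = measure lebesgue K" by auto
    qed
    also have "\<dots> = measure lebesgue (\<Union>(snd ` q))"
      by (rule content_division[OF qd])
    also have "\<dots> \<le> measure lebesgue U"
    proof (rule measure_mono_fmeasurable[OF _ _ Um(1)])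
      show "\<Union>(snd ` q) \<subseteq> U" using p(2) by (force simp: fine_def q_def \<gamma>_def)
      show "\<Union>(snd ` q) \<in> sets lebesgue"
        using lmeasurable_division[OF qd] by (rule fmeasurableD)
    qed
    finally have "(\<Sum>K\<in>snd ` q. Sup K - Inf K) < d" using Um(2) by linarith
    moreover have "\<Union>(snd ` q) \<subseteq> {a..b}" using pD(3) \<open>q \<subseteq> p\<close> by fastforce
    ultimately have small: "(\<Sum>K\<in>snd ` q. norm (f (Sup K) - f (Inf K))) < \<epsilon>"
      using d(2)[OF qd] by blast
    define g where "g K = (if K = {} then 0 else norm (f (Sup K) - f (Inf K)))" for K
    have g: "norm (f (Sup K) - f (Inf K)) = g K" if "(x, K) \<in> q" for x K
      using pD(2) that \<open>q \<subseteq> p\<close> by (auto simp: g_def)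
    have "(\<Sum>(x, K)\<in>q. norm (f (Sup K) - f (Inf K))) = (\<Sum>(x, K)\<in>q. g K)"
      using g by (intro sum.cong) auto
    also have "\<dots> = (\<Sum>K\<in>snd ` q. g K)"
      by (rule sum.over_tagged_division_lemma[OF q]) (auto simp: g_def not_less)
    also have "\<dots> = (\<Sum>K\<in>snd ` q. norm (f (Sup K) - f (Inf K)))"
      using g by (intro sum.cong) auto
    finally have "(\<Sum>(x, K)\<in>q. norm (f (Sup K) - f (Inf K))) = (\<Sum>K\<in>snd ` q. norm (f (Sup K) - f (Inf K)))" .
    with small have E_part: "norm (\<Sum>i\<in>q. ?\<Delta> i) \<le> \<epsilon>"
      by (intro order_trans[OF norm_sum]) (simp add: split_def)
    \<comment> \<open>Off \<open>E\<close> the derivative at the tag \<open>x\<close> controls both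
      endpoints, and \<open>u \<le> x \<le> v\<close> makes the two distances add up to
      \<open>v - u\<close>.\<close>
    have "norm (?\<Delta> i) \<le> \<epsilon> * (case i of (x, K) \<Rightarrow> Sup K - Inf K)" if "i \<in> p - q" for i
    proof -
      obtain x K where i: "i = (x, K)" "(x, K) \<in> p" "x \<notin> E" using \<open>i \<in> p - q\<close> by (auto simp: q_def)
      then obtain u v where uv: "K = {u..v}" "u \<le> v" "x \<in> {u..v}" "{u..v} \<subseteq> {a..b}" using pK by blast
      then have x: "x \<in> {a..b} - E" "u \<in> {a..b}" "v \<in> {a..b}" using i(3) by auto
      have "{u..v} \<subseteq> ball x (r x)" using p(2) i uv(1) by (force simp: fine_def \<gamma>_def)
      then have "u \<in> ball x (r x)" "v \<in> ball x (r x)" using uv(2) by auto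
      then have "norm (f u - f x) \<le> \<epsilon> * \<bar>u - x\<bar>" "norm (f v - f x) \<le> \<epsilon> * \<bar>v - x\<bar>"
        using r(2)[OF x(1,2)] r(2)[OF x(1,3)] by (auto simp: dist_real_def)
      then have "norm (f v - f u) \<le> \<epsilon> * \<bar>u - x\<bar> + \<epsilon> * \<bar>v - x\<bar>"
        using norm_triangle_ineq4[of "f v - f x" "f u - f x"] by simp
      also have "\<dots> = \<epsilon> * (v - u)" using uv(3) by (simp flip: distrib_left)
      finally show ?thesis using i uv by simp
    qed
    then have "norm (\<Sum>i\<in>p - q. ?\<Delta> i) \<le> (\<Sum>i\<in>p - q. \<epsilon> * (case i of (x, K) \<Rightarrow> Sup K - Inf K))"
      by (rule sum_norm_le)
    also have "\<dots> \<le> (\<Sum>i\<in>p. \<epsilon> * (case i of (x, K) \<Rightarrow> Sup K - Inf K))"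
    proof (rule sum_mono2[OF pD(1)])
      fix i assume "i \<in> p - (p - q)"
      then show "0 \<le> \<epsilon> * (case i of (x, K) \<Rightarrow> Sup K - Inf K)"
        using pK[of "fst i" "snd i"] \<open>0 < \<epsilon>\<close> by (auto simp: split_def)
    qed auto
    also have "\<dots> = \<epsilon> * (b - a)"
      unfolding sum_distrib_left[symmetric]
      using additive_tagged_division_1[OF \<open>a \<le> b\<close> p(1), of "\<lambda>x. x"] by simp
    finally have rest: "norm (\<Sum>i\<in>p - q. ?\<Delta> i) \<le> \<epsilon> * (b - a)" .
    have "f b - f a = (\<Sum>i\<in>p. ?\<Delta> i)"
      using additive_tagged_division_1[OF \<open>a \<le> b\<close> p(1), of f] by simp
    also have "\<dots> = (\<Sum>i\<in>p - q. ?\<Delta> i) + (\<Sum>i\<in>q. ?\<Delta> i)"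
      by (rule sum.subset_diff[OF \<open>q \<subseteq> p\<close> pD(1)])
    finally have "norm (f b - f a) \<le> \<epsilon> * (b - a) + \<epsilon>"
      using rest E_part by (smt (verit) norm_triangle_ineq)
    also have "\<dots> \<le> \<epsilon> * (2 + (b - a))" using \<open>0 < \<epsilon>\<close> by (simp add: algebra_simps)
    also have "\<dots> = e" using \<open>a \<le> b\<close> by (simp add: \<epsilon>_def)
    finally show ?thesis by simp
  qed
  then have "norm (f b - f a) \<le> 0" by (rule field_le_epsilon)
  then show ?thesis by simp
qed

section \<open>Integral form of the linear system\<close>

lemma AE_lebesgue_on_iff_negligible:
  assumes "S \<in> sets lebesgue"
  shows "(AE t in lebesgue_on S. P t) \<longleftrightarrow> negligible {t \<in> S. \<not> P t}"
proof -
  have "(AE t in lebesgue_on S. P t) \<longleftrightarrow> (AE t in lebesgue. t \<in> S \<longrightarrow> P t)"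
    using assms by (simp add: AE_restrict_space_iff)
  also have "\<dots> \<longleftrightarrow> negligible {t \<in> S. \<not> P t}"
    unfolding eventually_ae_filter_negligible by (auto intro: negligible_subset)
  finally show ?thesis .
qed

lemma bounded_bilinear_matrix_vector_mult:
  "bounded_bilinear ((*v) :: real ^ 'n ^ 'm \<Rightarrow> real ^ 'n \<Rightarrow> real ^ 'm)"
  unfolding bilinear_conv_bounded_bilinear[symmetric] bilinear_def
  by (auto intro!: linearI simp: matrix_vector_mult_add_rdistrib scaleR_matrix_vector_assoc
      matrix_vector_right_distrib matrix_vector_mult_scaleR)

lemma bounded_linear_transpose:
  "bounded_linear (transpose :: real ^ 'n ^ 'm \<Rightarrow> real ^ 'm ^ 'n)"
  unfolding linear_conv_bounded_linear[symmetric]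
  by (auto intro!: linearI simp: transpose_def vec_eq_iff)

section \<open>Integral equations with bounded measurable coefficients\<close>

lemma continuous_on_integral_atLeast:
  fixes h :: "real \<Rightarrow> 'b::banach"
  assumes "\<And>b. h integrable_on {a..b}"
  shows "continuous_on {a..} (\<lambda>t. integral {a..t} h)"
  unfolding continuous_on_eq_continuous_within
proof
  fix t assume t: "t \<in> {a..}"
  have "continuous_on {a..t+1} (\<lambda>t. integral {a..t} h)"
    by (rule indefinite_integral_continuous_1[OF assms])
  then have "continuous (at t within {a..t+1}) (\<lambda>t. integral {a..t} h)"
    using t by (auto simp: continuous_on_eq_continuous_within)
  moreover have "at t within {a..} = at t within {a..t+1}"
    by (rule at_within_nhd[of _ "{..<t+1}"]) auto
  ultimately show "continuous (at t within {a..}) (\<lambda>t. integral {a..t} h)" by simp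
qed

text \<open>The Caratheodory form of the equation. It has no exceptional null set, so fixed points,
  time shifts and linear combinations are handled without almost-everywhere arguments.\<close>

definition integral_solution :: "(real \<Rightarrow> real ^ 'n ^ 'n) \<Rightarrow> (real \<Rightarrow> real ^ 'n) \<Rightarrow> bool" where
  "integral_solution B z \<longleftrightarrow>
     continuous_on {0..} z \<and> (\<forall>t\<ge>0. ((\<lambda>s. B s *v z s) has_integral (z t - z 0)) {0..t})"

lemma bounded_matrices_operator_bound:
  fixes B :: "real \<Rightarrow> real ^ 'n ^ 'm"
  assumes "bounded (B ` {0..})"
  obtains C where "0 < C" "\<And>t y. 0 \<le> t \<Longrightarrow> norm (B t *v y) \<le> C * norm y"
proof -
  obtain K where K: "0 < K" "\<And>(A :: real ^ 'n ^ 'm) y. norm (A *v y) \<le> norm A * norm y * K"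
    using bounded_bilinear.pos_bounded[OF bounded_bilinear_matrix_vector_mult] by blast
  obtain b where b: "0 < b" "\<And>t. 0 \<le> t \<Longrightarrow> norm (B t) \<le> b"
    using assms unfolding bounded_pos by auto
  have "norm (B t *v y) \<le> b * K * norm y" if "0 \<le> t" for t y
  proof -
    have "norm (B t *v y) \<le> norm (B t) * (norm y * K)" using K(2)[of "B t" y] by (simp add: ac_simps)
    also have "\<dots> \<le> b * (norm y * K)" using b(2)[OF that] K(1) by (intro mult_right_mono) auto
    finally show ?thesis by (simp add: ac_simps)
  qed
  with K(1) b(1) show thesis by (intro that[of "b * K"]) auto
qed

text \<open>The integrand is a continuous function of two measurable ones, and it is bounded on the
  compact interval.\<close>

lemma integrable_matrix_vector_mult:
  fixes B :: "real \<Rightarrow> real ^ 'n ^ 'm"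
  assumes B: "B \<in> borel_measurable (lebesgue_on {0..})" "bounded (B ` {0..})"
    and w: "continuous_on {0..t} w"
  shows "(\<lambda>s. B s *v w s) integrable_on {0..t}"
proof -
  obtain C where C: "0 < C" "\<And>s y. 0 \<le> s \<Longrightarrow> norm (B s *v y) \<le> C * norm y"
    using bounded_matrices_operator_bound[OF B(2)] by blast
  obtain D where D: "\<And>s. s \<in> {0..t} \<Longrightarrow> norm (w s) \<le> D"
    using compact_imp_bounded[OF compact_continuous_image[OF w compact_Icc]]
    unfolding bounded_iff by (metis imageI)
  show ?thesis
  proof (rule measurable_bounded_by_integrable_imp_integrable[where g = "\<lambda>_. C * D"])
    show "(\<lambda>s. B s *v w s) \<in> borel_measurable (lebesgue_on {0..t})"
    proof (rule borel_measurable_continuous_Pair[where H = "(*v)" and f = B and g = w])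
      show "B \<in> borel_measurable (lebesgue_on {0..t})"
        by (rule measurable_restrict_mono[OF B(1)]) auto
      show "w \<in> borel_measurable (lebesgue_on {0..t})"
        by (rule continuous_imp_measurable_on_sets_lebesgue[OF w]) auto
      show "continuous_on UNIV (\<lambda>x :: (real ^ 'n ^ 'm) \<times> (real ^ 'n). fst x *v snd x)"
        by (intro bounded_bilinear.continuous_on[OF bounded_bilinear_matrix_vector_mult] continuous_intros)
    qed
    fix s assume s: "s \<in> {0..t}"
    then have "norm (B s *v w s) \<le> C * norm (w s)" by (intro C) auto
    also have "\<dots> \<le> C * D" using C(1) D[OF s] by simp
    finally show "norm (B s *v w s) \<le> C * D" .
  qed auto
qed

text \<open>In the norm \<open>sup (exp (- 2 C t) * norm (z t))\<close>, where \<open>C\<close> bounds the coefficients, the Picard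
  operator is a contraction on the whole half-line.\<close>

lemma integral_solution_exists:
  fixes B :: "real \<Rightarrow> real ^ 'n ^ 'n"
  assumes B: "B \<in> borel_measurable (lebesgue_on {0..})" "bounded (B ` {0..})"
  obtains z where "integral_solution B z" "z 0 = y"
proof -
  obtain C where C: "0 < C" "\<And>s y. 0 \<le> s \<Longrightarrow> norm (B s *v y) \<le> C * norm y"
    using bounded_matrices_operator_bound[OF B(2)] by blast
  define E where "E t = exp (2 * C * t)" for t
  have cE: "continuous_on S E" for S unfolding E_def by (intro continuous_intros)
  have E: "0 < E t" for t by (simp add: E_def)
  have int: "(\<lambda>s. B s *v (E s *\<^sub>R w s)) integrable_on {0..t}" if "continuous_on UNIV w" for t w
    by (rule integrable_matrix_vector_mult[OF B])
       (intro continuous_intros cE continuous_on_subset[OF that subset_UNIV])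
  have est: "norm (integral {0..t} (\<lambda>s. B s *v (E s *\<^sub>R w s))) \<le> E t * (D / 2)"
    if w: "continuous_on UNIV w" "\<And>s. norm (w s) \<le> D" and "0 \<le> t" for t w D
  proof -
    have D: "0 \<le> D" using w(2)[of 0] norm_ge_zero order_trans by blast
    \<comment> \<open>Since \<open>E' = 2 * C * E\<close>, the function \<open>C * E * D\<close> has
      antiderivative \<open>E * D / 2\<close>; this is the source of the contraction factor
      \<open>1 / 2\<close>.\<close>
    have hi: "((\<lambda>s. C * (E s * D)) has_integral (E t * (D / 2) - E 0 * (D / 2))) {0..t}"
      unfolding E_def using \<open>0 \<le> t\<close>
      by (intro fundamental_theorem_of_calculus)
         (auto intro!: derivative_eq_intros simp flip: has_real_derivative_iff_has_vector_derivative)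
    have "norm (B s *v (E s *\<^sub>R w s)) \<le> C * (E s * D)" if "s \<in> {0..t}" for s
    proof -
      have "norm (B s *v (E s *\<^sub>R w s)) \<le> C * norm (E s *\<^sub>R w s)" using that by (intro C) auto
      also have "\<dots> \<le> C * (E s * D)" using C(1) E[of s] w(2) by simp
      finally show ?thesis .
    qed
    from Henstock_Kurzweil_Integration.integral_norm_bound_integral[OF int[OF w(1)] has_integral_integrable[OF hi] this]
    have "norm (integral {0..t} (\<lambda>s. B s *v (E s *\<^sub>R w s))) \<le> E t * (D / 2) - E 0 * (D / 2)"
      unfolding integral_unique[OF hi] .
    also have "\<dots> \<le> E t * (D / 2)" using D E[of 0] by simp
    finally show ?thesis .
  qed
  have scale: "norm ((1 / E t) *\<^sub>R a) \<le> b" if "norm a \<le> E t * b" for t b and a :: "real ^ 'n"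
    using E[of t] that by (simp add: pos_divide_le_eq mult.commute)
  \<comment> \<open>The unknown is \<open>w = z / E\<close>. Replacing \<open>t\<close> by
    \<open>max 0 t\<close> extends everything constantly to negative times, so that
    \<open>P w\<close> lives in the Banach space of bounded continuous functions on all of
    \<open>real\<close>.\<close>
  define P where "P w t = (1 / E (max 0 t)) *\<^sub>R
    (y + integral {0..max 0 t} (\<lambda>s. B s *v (E s *\<^sub>R w s)))" for w t
  have P_bcontfun: "P u \<in> bcontfun" for u :: "real \<Rightarrow>\<^sub>C (real ^ 'n)"
  proof (rule bcontfun_normI)
    have "continuous_on UNIV (\<lambda>t. integral {0..max 0 t} (\<lambda>s. B s *v (E s *\<^sub>R u s)))"
      by (rule continuous_on_compose2[OF continuous_on_integral_atLeast[OF int]])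
         (auto intro!: continuous_intros)
    moreover have "continuous_on UNIV (\<lambda>t. E (max 0 t))" unfolding E_def by (intro continuous_intros)
    ultimately show "continuous_on UNIV (P u)"
      unfolding P_def using E by (intro continuous_intros) (auto simp: less_imp_neq[symmetric])
    fix t :: real
    let ?t = "max 0 t"
    have "norm (integral {0..?t} (\<lambda>s. B s *v (E s *\<^sub>R u s))) \<le> E ?t * (norm u / 2)"
      by (rule est) (auto simp: norm_bounded)
    moreover have "norm y \<le> E ?t * norm y" using C(1) by (simp add: E_def mult_le_cancel_right1)
    ultimately have "norm (y + integral {0..?t} (\<lambda>s. B s *v (E s *\<^sub>R u s)))
        \<le> E ?t * (norm y + norm u / 2)"
      by (intro norm_triangle_le) (simp add: distrib_left)
    then show "norm (P u t) \<le> norm y + norm u / 2"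
      unfolding P_def by (rule scale)
  qed
  define Q where "Q u = Bcontfun (P (apply_bcontfun u))" for u
  have Q: "apply_bcontfun (Q u) = P u" for u
    unfolding Q_def by (rule Bcontfun_inverse[OF P_bcontfun])
  have "dist (Q u) (Q w) \<le> 1 / 2 * dist u w" for u w
  proof (rule dist_bound)
    fix t :: real
    let ?t = "max 0 t"
    have "integral {0..?t} (\<lambda>s. B s *v (E s *\<^sub>R (u s - w s))) =
        integral {0..?t} (\<lambda>s. B s *v (E s *\<^sub>R u s)) - integral {0..?t} (\<lambda>s. B s *v (E s *\<^sub>R w s))"
      using int[of u ?t] int[of w ?t]
      by (simp add: scaleR_diff_right matrix_vector_mult_diff_distrib
          Henstock_Kurzweil_Integration.integral_diff)
    then have P_diff: "P u t - P w t = (1 / E ?t) *\<^sub>R integral {0..?t} (\<lambda>s. B s *v (E s *\<^sub>R (u s - w s)))"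
      by (simp add: P_def flip: scaleR_diff_right)
    have "norm (integral {0..?t} (\<lambda>s. B s *v (E s *\<^sub>R (u s - w s)))) \<le> E ?t * (dist u w / 2)"
      by (rule est) (auto intro!: continuous_intros simp: dist_bounded simp flip: dist_norm)
    from scale[OF this] have "norm (P u t - P w t) \<le> dist u w / 2" by (simp only: P_diff)
    then show "dist (Q u t) (Q w t) \<le> 1 / 2 * dist u w"
      by (simp add: Q dist_norm[of "P u t"])
  qed
  then obtain u where u: "Q u = u"
    using banach_fix_type[of "1 / 2" Q] by auto
  \<comment> \<open>Undoing the weight turns the fixed point equation into the integral equation for
    \<open>z\<close>.\<close>
  define z where "z t = E t *\<^sub>R u t" for t
  have cz: "continuous_on S z" for S unfolding z_def by (intro continuous_intros cE) auto
  have z: "z t = y + integral {0..t} (\<lambda>s. B s *v z s)" if "0 \<le> t" for t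
  proof -
    have "z t = E t *\<^sub>R P u t" by (simp add: z_def u flip: Q)
    then show ?thesis using E[of t] that by (simp add: P_def z_def less_imp_neq[symmetric])
  qed
  have z0: "z 0 = y" using z[of 0] by simp
  moreover have "((\<lambda>s. B s *v z s) has_integral (z t - z 0)) {0..t}" if "0 \<le> t" for t
    using integrable_integral[OF integrable_matrix_vector_mult[OF B cz]] z[OF that] z0 by simp
  ultimately show thesis
    using cz by (intro that[of z]) (auto simp: integral_solution_def)
qed

section \<open>Restarting, superposing and differentiating integral solutions\<close>

lemma integral_solution_has_integral:
  assumes "integral_solution B z" "0 \<le> s" "s \<le> t"
  shows "((\<lambda>r. B r *v z r) has_integral (z t - z s)) {s..t}"
proof -
  let ?h = "\<lambda>r. B r *v z r"
  have h: "(?h has_integral (z r - z 0)) {0..r}" if "0 \<le> r" for r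
    using assms(1) that by (simp add: integral_solution_def)
  have "?h integrable_on {0..t}" using h[of t] assms by auto
  then have int: "?h integrable_on {s..t}"
    and comb: "integral {0..s} ?h + integral {s..t} ?h = integral {0..t} ?h"
    using assms by (auto intro: integrable_on_subinterval Henstock_Kurzweil_Integration.integral_combine)
  have "integral {s..t} ?h = integral {0..t} ?h - integral {0..s} ?h" by (simp flip: comb)
  also have "\<dots> = z t - z s"
    using integral_unique[OF h[of s]] integral_unique[OF h[of t]] assms by simp
  finally show ?thesis using int by (simp add: has_integral_iff)
qed

lemma integral_solution_shift:
  assumes "integral_solution B z" "0 \<le> t"
  shows "integral_solution (\<lambda>s. B (t + s)) (\<lambda>s. z (t + s))"
  unfolding integral_solution_def
proof (intro conjI allI impI)
  show "continuous_on {0..} (\<lambda>s. z (t + s))"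
    using assms unfolding integral_solution_def
    by (auto intro!: continuous_on_compose2[of "{0..}" z] continuous_intros)
  fix s :: real assume "0 \<le> s"
  then have "((\<lambda>r. B r *v z r) has_integral (z (t + s) - z t)) {t..t + s}"
    using assms by (intro integral_solution_has_integral) auto
  from has_integral_shift_real_ivl[OF this, of t]
  show "((\<lambda>r. B (t + r) *v z (t + r)) has_integral (z (t + s) - z (t + 0))) {0..s}"
    by (simp add: add.commute)
qed

lemma integral_solution_sum:
  assumes "finite I" "\<And>i. i \<in> I \<Longrightarrow> integral_solution B (X i)"
  shows "integral_solution B (\<lambda>t. \<Sum>i\<in>I. c i *\<^sub>R X i t)"
  unfolding integral_solution_def
proof (intro conjI allI impI)
  show "continuous_on {0..} (\<lambda>t. \<Sum>i\<in>I. c i *\<^sub>R X i t)"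
    using assms(2) unfolding integral_solution_def by (intro continuous_intros) auto
  fix t :: real assume "0 \<le> t"
  then have "((\<lambda>s. \<Sum>i\<in>I. c i *\<^sub>R (B s *v X i s)) has_integral (\<Sum>i\<in>I. c i *\<^sub>R (X i t - X i 0))) {0..t}"
    using assms unfolding integral_solution_def by (intro has_integral_sum has_integral_cmul) auto
  then show "((\<lambda>s. B s *v (\<Sum>i\<in>I. c i *\<^sub>R X i s)) has_integral
      ((\<Sum>i\<in>I. c i *\<^sub>R X i t) - (\<Sum>i\<in>I. c i *\<^sub>R X i 0))) {0..t}"
    by (simp add: linear_sum[OF matrix_vector_mul_linear] matrix_vector_mult_scaleR
        scaleR_diff_right sum_subtractf)
qed

text \<open>On a compact interval the integrand is bounded, so \<open>z\<close> is Lipschitz there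
  and hence absolutely continuous. The equation almost everywhere is Lebesgue differentiation of the
  indefinite integral.\<close>

lemma integral_solution_imp_linear_solution:
  assumes bnd: "bounded (B ` {0..})" and z: "integral_solution B z"
  shows "linear_solution B z"
  unfolding linear_solution_def
proof (intro conjI allI impI)
  let ?h = "\<lambda>s. B s *v z s"
  obtain C where C: "0 < C" "\<And>s y. 0 \<le> s \<Longrightarrow> norm (B s *v y) \<le> C * norm y"
    using bounded_matrices_operator_bound[OF bnd] by blast
  fix b :: real assume "0 \<le> b"
  have "continuous_on {0..b} z"
    using z by (auto simp: integral_solution_def intro: continuous_on_subset)
  then have "bounded (z ` {0..b})"
    by (intro compact_imp_bounded compact_continuous_image compact_Icc)
  then obtain D where D: "0 < D" "\<And>s. s \<in> {0..b} \<Longrightarrow> norm (z s) \<le> D"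
    unfolding bounded_pos by (metis imageI)
  show "abs_continuous_on_interval 0 b z"
  proof (rule lipschitz_imp_abs_continuous_on_interval)
    fix s t assume st: "0 \<le> s" "s \<le> t" "t \<le> b"
    have "norm (?h r) \<le> C * D" if "r \<in> cbox s t" for r
    proof -
      have "norm (?h r) \<le> C * norm (z r)" using that st by (intro C) auto
      also have "\<dots> \<le> C * D" using D(2)[of r] C(1) that st by auto
      finally show ?thesis .
    qed
    with has_integral_bound[of "C * D" ?h "z t - z s" s t] integral_solution_has_integral[OF z st(1,2)]
    show "norm (z t - z s) \<le> C * D * (t - s)"
      using C(1) D(1) st by simp
  qed
next
  let ?h = "\<lambda>s. B s *v z s"
  let ?F = "\<lambda>s. integral {0..s} ?h"
  have h: "(?h has_integral (z t - z 0)) {0..t}" if "0 \<le> t" for t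
    using z that by (simp add: integral_solution_def)
  \<comment> \<open>The differentiation theorem concerns open bounded intervals, so the half-line is
    exhausted by countably many of them and the endpoint \<open>0\<close> is added to the null
    set.\<close>
  define N where "N n = {t\<in>{0<..<real n}. \<not> (?F has_vector_derivative ?h t) (at t)}" for n
  have "?h integrable_on {0..real n}" for n using h[of "real n"] by auto
  then have N: "negligible (insert 0 (\<Union>n. N n))"
    unfolding N_def by (intro iffD2[OF negligible_insert] negligible_Union_nat lebesgue_differentiation)
  have "(z has_vector_derivative ?h t) (at t within {0..})"
    if t: "0 \<le> t" "t \<notin> insert 0 (\<Union>n. N n)" for t
  proof -
    obtain n where "t < real n" using reals_Archimedean2 by blast
    with t have "(?F has_vector_derivative ?h t) (at t)" by (auto simp: N_def)
    then have F: "((\<lambda>s. z 0 + ?F s) has_vector_derivative ?h t) (at t)"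
      by (auto intro!: derivative_eq_intros)
    have "z 0 + ?F s = z s" if "s \<in> {0<..}" for s
      using h[of s] that by (auto simp: has_integral_iff)
    then have "(z has_vector_derivative ?h t) (at t)"
      using t by (intro has_vector_derivative_transform_within_open[OF F, of "{0<..}"]) auto
    then show ?thesis by (rule has_vector_derivative_at_within)
  qed
  then have "{t \<in> {0..}. \<not> (z has_vector_derivative ?h t) (at t within {0..})} \<subseteq> insert 0 (\<Union>n. N n)"
    by auto
  then show "AE t in lebesgue_on {0..}. (z has_vector_derivative ?h t) (at t within {0..})"
    by (subst AE_lebesgue_on_iff_negligible) (auto intro: negligible_subset[OF N])
qed

section \<open>Duality\<close>

text \<open>In the product rule the two terms cancel by transposition, at all times outside a null
  set. As the pairing is absolutely continuous, this is enough for constancy.\<close>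

lemma linear_solution_inner_adjoint_solution:
  assumes x: "linear_solution A x" and l: "adjoint_solution A l" and "0 \<le> t"
  shows "l t \<bullet> x t = l 0 \<bullet> x 0"
proof -
  define E where "E = {s\<in>{0..}. \<not> (x has_vector_derivative A s *v x s) (at s within {0..})} \<union>
    {s\<in>{0..}. \<not> (l has_vector_derivative - transpose (A s) *v l s) (at s within {0..})}"
  have E: "negligible E"
    using x l unfolding E_def adjoint_solution_def linear_solution_def
    by (intro negligible_Un) (auto simp: AE_lebesgue_on_iff_negligible)
  have ac: "abs_continuous_on_interval 0 t (\<lambda>s. l s \<bullet> x s)"
    using x l \<open>0 \<le> t\<close> unfolding adjoint_solution_def linear_solution_def
    by (intro abs_continuous_on_interval_inner) auto
  have "((\<lambda>s. l s \<bullet> x s) has_vector_derivative 0) (at s within {0..t})" if "s \<in> {0..t} - E" for s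
  proof -
    have "(x has_vector_derivative A s *v x s) (at s within {0..t})"
      "(l has_vector_derivative - transpose (A s) *v l s) (at s within {0..t})"
      using that by (auto simp: E_def intro: has_vector_derivative_within_subset)
    from bounded_bilinear.has_vector_derivative[OF bounded_bilinear_inner this(2,1)]
    have "((\<lambda>s. l s \<bullet> x s) has_vector_derivative
        (l s \<bullet> (A s *v x s) + (- transpose (A s) *v l s) \<bullet> x s)) (at s within {0..t})" .
    moreover have "(- transpose (A s) *v l s) \<bullet> x s = - (l s \<bullet> (A s *v x s))"
      by (simp add: bounded_bilinear.minus_left[OF bounded_bilinear_matrix_vector_mult] dot_lmul_matrix)
    ultimately show ?thesis by simp
  qed
  from abs_continuous_zero_derivative_imp_constant[OF ac \<open>0 \<le> t\<close> E this] show ?thesis .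
qed

lemma adjoint_coefficients:
  fixes A :: "real \<Rightarrow> real ^ 'n ^ 'n"
  assumes "A \<in> borel_measurable (lebesgue_on {0..})" "bounded (A ` {0..})"
  shows "(\<lambda>t. - transpose (A t)) \<in> borel_measurable (lebesgue_on {0..})"
    "bounded ((\<lambda>t. - transpose (A t)) ` {0..})"
proof -
  have bl: "bounded_linear (\<lambda>B :: real ^ 'n ^ 'n. - transpose B)"
    by (intro bounded_linear_minus bounded_linear_transpose)
  show "(\<lambda>t. - transpose (A t)) \<in> borel_measurable (lebesgue_on {0..})"
    by (rule borel_measurable_continuous_on[OF linear_continuous_on[OF bl] assms(1)])
  show "bounded ((\<lambda>t. - transpose (A t)) ` {0..})"
    using bounded_linear_image[OF assms(2) bl] by (simp add: image_image)
qed

text \<open>A solution vanishing at time \<open>T\<close> is orthogonal to all adjoint solutions, so it vanishes at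
  \<open>0\<close>; hence the linear map from initial values to values at \<open>T\<close> is injective and thus
  surjective.\<close>

lemma integral_solution_exists_at:
  fixes B :: "real \<Rightarrow> real ^ 'n ^ 'n"
  assumes B: "B \<in> borel_measurable (lebesgue_on {0..})" "bounded (B ` {0..})" and T: "0 \<le> T"
  obtains z where "integral_solution B z" "z T = y"
proof -
  have "\<exists>z. integral_solution B z \<and> z 0 = axis i 1" for i
    using integral_solution_exists[OF B] by metis
  then obtain X where X: "\<And>i. integral_solution B (X i)" "\<And>i. X i 0 = axis i 1" by metis
  \<comment> \<open>The \<open>X i\<close> are the columns of the fundamental matrix:
    \<open>Z c\<close> is the solution with initial value \<open>c\<close>, and it depends linearly
    on \<open>c\<close>.\<close>
  define Z where "Z c t = (\<Sum>i\<in>UNIV. (c $ i) *\<^sub>R X i t)" for c t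
  have Z: "integral_solution B (Z c)" for c
    unfolding Z_def by (intro integral_solution_sum X) auto
  have Z0: "Z c 0 = c" for c
    by (simp add: Z_def X(2) vec_eq_iff axis_def if_distrib cong: if_cong)
  have lin: "linear (\<lambda>c. Z c T)"
    by (auto intro!: linearI simp: Z_def scaleR_add_left sum.distrib scaleR_sum_right)
  have "c = 0" if "Z c T = 0" for c
  proof -
    \<comment> \<open>With \<open>l 0 = c\<close> the pairing at time \<open>0\<close> is
      \<open>c \<bullet> c\<close>, while at time \<open>T\<close> it is \<open>0\<close>.\<close>
    obtain l where l: "integral_solution (\<lambda>t. - transpose (B t)) l" "l 0 = c"
      using integral_solution_exists[OF adjoint_coefficients[OF B]] by metis
    have "l T \<bullet> Z c T = l 0 \<bullet> Z c 0"
      using T B Z l(1) adjoint_coefficients[OF B]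
      by (intro linear_solution_inner_adjoint_solution[where A = B])
         (auto simp: adjoint_solution_def intro: integral_solution_imp_linear_solution)
    with that l(2) Z0 show ?thesis by simp
  qed
  then have "inj (\<lambda>c. Z c T)" by (simp add: linear_injective_0[OF lin])
  then obtain c where "Z c T = y"
    using linear_injective_imp_surjective[OF lin] by (metis surjE)
  with Z show thesis by (rule that)
qed

section \<open>Switching laws: time shifts and constant laws\<close>

text \<open>The Barabanov inequality compares a solution only with its value at time
  \<open>0\<close>. Shifting the law allows a comparison with its value at any time
  \<open>t\<close>.\<close>

lemma switching_law_shift:
  assumes "switching_law M A" "0 \<le> t"
  shows "switching_law M (\<lambda>s. A (t + s))"
proof -
  \<comment> \<open>Extension by zero gives a measurable function on the whole line, where
    composition with a translation is available.\<close>
  have "(\<lambda>s. if s \<in> {0..} then A s else 0) \<in> borel_measurable lebesgue"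
    using assms(1) by (intro borel_measurable_if_I) (auto simp: switching_law_def)
  from borel_measurable_affine[OF this, of 1 t]
  have "(\<lambda>s. if t + s \<in> {0..} then A (t + s) else 0) \<in> borel_measurable (lebesgue_on {0..})"
    by (intro measurable_restrict_space1) (simp cong: if_cong)
  also have "?this \<longleftrightarrow> (\<lambda>s. A (t + s)) \<in> borel_measurable (lebesgue_on {0..})"
    using assms(2) by (intro measurable_cong) auto
  finally show ?thesis using assms by (auto simp: switching_law_def)
qed

lemma switching_law_bounded:
  assumes "switching_law M A" "bounded M"
  shows "bounded (A ` {0..})"
  using assms by (auto simp: switching_law_def intro: bounded_subset)

lemma integral_solution_imp_switched_solution:
  assumes "switching_law M A" "bounded M" "integral_solution A z"
  shows "switched_solution M z"
  using assms switching_law_bounded integral_solution_imp_linear_solution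
  unfolding switched_solution_def by blast

text \<open>For a constant law the integrand is continuous, so the one-sided derivative exists at
  the specific time \<open>0\<close>, not merely at almost every time.\<close>

lemma integral_solution_const_has_vector_derivative:
  assumes "integral_solution (\<lambda>_. A) z"
  shows "(z has_vector_derivative A *v z 0) (at 0 within {0..1})"
proof -
  let ?h = "\<lambda>s. A *v z s"
  have "continuous_on {0..1} ?h"
    using assms unfolding integral_solution_def
    by (intro linear_continuous_on_compose[OF _ matrix_vector_mul_linear]) (auto intro: continuous_on_subset)
  then have "((\<lambda>s. integral {0..s} ?h) has_vector_derivative ?h 0) (at 0 within {0..1})"
    by (rule integral_has_vector_derivative) simp
  then have F: "((\<lambda>s. z 0 + integral {0..s} ?h) has_vector_derivative ?h 0) (at 0 within {0..1})"
    by (auto intro!: derivative_eq_intros)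
  have eq: "z s = z 0 + integral {0..s} ?h" if "s \<in> {0..1}" for s
    using assms that by (auto simp: integral_solution_def dest!: spec[of _ s] integral_unique)
  show ?thesis
    by (rule has_vector_derivative_transform[OF _ eq F]) simp
qed

section \<open>Transport of subgradients along an extremal solution\<close>

text \<open>A zero subgradient is possible only at \<open>x T = 0\<close>, and the pairing identity
  forces the adjoint solution ending there to vanish identically. The assumption
  \<open>lhat \<noteq> 0\<close> excludes this degenerate choice.\<close>

theorem theorem2:
  fixes M :: "(real ^ 'n ^ 'n) set"
    and v :: "real ^ 'n \<Rightarrow> real"
    and x :: "real \<Rightarrow> real ^ 'n"
    and Ahat :: "real \<Rightarrow> real ^ 'n ^ 'n"
    and x0 lhat :: "real ^ 'n"
    and T :: real
  assumes "compact M" and "convex M" and "irreducible_matrices M"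
    and "max_lyapunov_exponent M = 0"
    and "barabanov_norm M v"
    and "extremal_solution M v x" and "x 0 = x0"
    and "switching_law M Ahat" and "linear_solution Ahat x"
    and "T \<ge> 0" and "lhat \<in> subdifferential v (x T)"
    and "lhat \<noteq> 0"
  shows "\<exists>l. adjoint_solution Ahat l \<and> (\<exists>t\<ge>0. l t \<noteq> 0) \<and>
           (\<forall>t\<in>{0..T}. l t \<in> subdifferential v (x t)) \<and>
           (AE t in lebesgue_on {0..T}.
              is_arg_max (\<lambda>A. l t \<bullet> (A *v x t)) (\<lambda>A. A \<in> M) (Ahat t) \<and>
              l t \<bullet> (Ahat t *v x t) = 0) \<and>
           l T = lhat"
proof -
  note law = \<open>switching_law M Ahat\<close> and x = \<open>linear_solution Ahat x\<close> and T = \<open>T \<ge> 0\<close>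
  have M: "bounded M" using \<open>compact M\<close> by (rule compact_imp_bounded)
  have meas: "Ahat \<in> borel_measurable (lebesgue_on {0..})" using law by (simp add: switching_law_def)
  have bnd: "bounded (Ahat ` {0..})" using law M by (rule switching_law_bounded)
  have v_decr: "v (z t) \<le> v (z 0)" if "switched_solution M z" "0 \<le> t" for z t
    using that \<open>barabanov_norm M v\<close> by (simp add: barabanov_norm_def)
  have v_const: "v (x t) = v (x T)" if "0 \<le> t" for t
    using that T \<open>extremal_solution M v x\<close> unfolding extremal_solution_def by metis
  have lhat: "lhat \<bullet> x T = v (x T)" "\<And>y. lhat \<bullet> y \<le> v y"
    using \<open>lhat \<in> subdifferential v (x T)\<close> by (auto simp: subdifferential_def)
  obtain l where l: "integral_solution (\<lambda>t. - transpose (Ahat t)) l" "l T = lhat"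
    using integral_solution_exists_at[OF adjoint_coefficients[OF meas bnd] T] .
  have adj: "adjoint_solution Ahat l"
    unfolding adjoint_solution_def
    by (rule integral_solution_imp_linear_solution[OF adjoint_coefficients(2)[OF meas bnd] l(1)])
  have dual: "l t \<bullet> z t = lhat \<bullet> z T" if "linear_solution Ahat z" "0 \<le> t" for z t
    using linear_solution_inner_adjoint_solution[OF that(1) adj] that(2) T l(2) by metis
  have l_x: "l t \<bullet> x t = v (x t)" if "0 \<le> t" for t
    using dual[OF x that] lhat(1) v_const[OF that] by simp
  have l_le: "l t \<bullet> y \<le> v y" if "t \<in> {0..T}" for t y
  proof -
    have t: "0 \<le> t" "0 \<le> T - t" using that by auto
    \<comment> \<open>The point \<open>y\<close> is prescribed at the intermediate time
      \<open>t\<close>, so the equation is solved backwards to \<open>0\<close> as well as forwards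
      to \<open>T\<close>.\<close>
    obtain z where z: "integral_solution Ahat z" "z t = y"
      using integral_solution_exists_at[OF meas bnd t(1)] .
    have "l t \<bullet> y = lhat \<bullet> z T"
      using dual[OF integral_solution_imp_linear_solution[OF bnd z(1)] t(1)] z(2) by simp
    also have "\<dots> \<le> v (z T)" by (rule lhat(2))
    also have "\<dots> \<le> v (z t)"
      \<comment> \<open>The solution restarted at time \<open>t\<close> runs for the remaining time
        \<open>T - t\<close>.\<close>
      using v_decr[OF integral_solution_imp_switched_solution[OF switching_law_shift[OF law t(1)] M
          integral_solution_shift[OF z(1) t(1)]] t(2)] by simp
    finally show ?thesis by (simp add: z(2))
  qed
  have nonpos: "l t \<bullet> (A *v x t) \<le> 0" if t: "t \<in> {0..T}" and A: "A \<in> M" for t A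
  proof (rule ccontr)
    assume "\<not> l t \<bullet> (A *v x t) \<le> 0"
    have "bounded ((\<lambda>_. A) ` {0::real..})" by (rule bounded_subset[of "{A}"]) auto
    then obtain z where z: "integral_solution (\<lambda>_. A) z" "z 0 = x t"
      using integral_solution_exists[of "\<lambda>_. A" "x t"] by auto
    \<comment> \<open>A positive derivative would push \<open>l t \<bullet> z h\<close> above
      \<open>v (x t)\<close> for small \<open>h\<close>, although it is at most
      \<open>v (z h) \<le> v (x t)\<close>.\<close>
    have "((\<lambda>s. l t \<bullet> z s) has_real_derivative l t \<bullet> (A *v x t)) (at 0 within {0..1})"
      using bounded_linear.has_vector_derivative[OF bounded_linear_inner_right
          integral_solution_const_has_vector_derivative[OF z(1)]] z(2)
      by (simp add: has_real_derivative_iff_has_vector_derivative)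
    from has_real_derivative_pos_inc_right[OF this] \<open>\<not> l t \<bullet> (A *v x t) \<le> 0\<close>
    obtain d where d: "0 < d" "\<And>h. \<lbrakk>0 < h; h \<in> {0..1}; h < d\<rbrakk> \<Longrightarrow> l t \<bullet> z 0 < l t \<bullet> z h"
      by auto
    define h where "h = min (d / 2) 1"
    have h: "0 < h" "h \<in> {0..1}" "h < d" using d(1) by (auto simp: h_def)
    have "switched_solution M z"
      using A by (intro integral_solution_imp_switched_solution[OF _ M z(1)]) (simp add: switching_law_def)
    then have "v (z h) \<le> v (x t)" using v_decr[of z h] h z(2) by simp
    moreover have "v (x t) < l t \<bullet> z h" using d(2)[OF h] l_x[of t] z(2) t by simp
    ultimately show False using l_le[OF t, of "z h"] by linarith
  qed
  have zero: "l t \<bullet> (Ahat t *v x t) = 0"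
    if t: "t \<in> {0..T}" "t \<noteq> 0" and deriv: "(x has_vector_derivative Ahat t *v x t) (at t within {0..})" for t
  proof -
    have "at t within {0..} = at t" using t by (intro at_within_interior) auto
    with bounded_linear.has_vector_derivative[OF bounded_linear_inner_right deriv]
    have "((\<lambda>s. l t \<bullet> x s) has_real_derivative l t \<bullet> (Ahat t *v x t)) (at t)"
      by (simp add: has_real_derivative_iff_has_vector_derivative)
    moreover have "0 < t" using t by auto
    \<comment> \<open>The radius \<open>t\<close> keeps \<open>s\<close> nonnegative, where
      \<open>v (x s)\<close> is constant. The subgradient \<open>l t\<close> is fixed, so
      \<open>s\<close> may exceed \<open>T\<close>; a two-sided maximum is thus available even at
      \<open>t = T\<close>, and only \<open>t = 0\<close> is left out.\<close>
    moreover have "\<forall>s. \<bar>t - s\<bar> < t \<longrightarrow> l t \<bullet> x s \<le> l t \<bullet> x t"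
    proof (intro allI impI)
      fix s assume "\<bar>t - s\<bar> < t"
      then have "0 \<le> s" by linarith
      then show "l t \<bullet> x s \<le> l t \<bullet> x t"
        using l_le[OF t(1), of "x s"] l_x[of t] v_const[of s] v_const[of t] t by simp
    qed
    ultimately show ?thesis by (rule DERIV_local_max)
  qed
  have "negligible {t \<in> {0..}. \<not> (x has_vector_derivative Ahat t *v x t) (at t within {0..})}" (is "negligible ?N")
    using x by (simp add: linear_solution_def AE_lebesgue_on_iff_negligible)
  then have N: "negligible (insert 0 ?N)" by simp
  have "{t \<in> {0..T}. l t \<bullet> (Ahat t *v x t) \<noteq> 0} \<subseteq> insert 0 ?N" using zero by auto
  then have "AE t in lebesgue_on {0..T}. l t \<bullet> (Ahat t *v x t) = 0"
    by (subst AE_lebesgue_on_iff_negligible) (auto intro: negligible_subset[OF N])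
  moreover have "AE t in lebesgue_on {0..T}. t \<in> {0..T}"
    by (rule AE_I2) simp
  ultimately have "AE t in lebesgue_on {0..T}.
      is_arg_max (\<lambda>A. l t \<bullet> (A *v x t)) (\<lambda>A. A \<in> M) (Ahat t) \<and> l t \<bullet> (Ahat t *v x t) = 0"
  \<comment> \<open>The value at \<open>Ahat t\<close> is \<open>0\<close>, and no matrix of
    \<open>M\<close> exceeds it by \<open>nonpos\<close>; membership of \<open>Ahat t\<close> in
    \<open>M\<close> holds at every nonnegative time.\<close>
  proof eventually_elim
    case (elim t)
    with nonpos[of t] law show ?case
      by (auto simp: is_arg_max_def switching_law_def not_less)
  qed
  moreover have "\<forall>t\<in>{0..T}. l t \<in> subdifferential v (x t)"
    using l_x l_le by (simp add: subdifferential_def)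
  moreover have "\<exists>t\<ge>0. l t \<noteq> 0" using T l(2) \<open>lhat \<noteq> 0\<close> by blast
  ultimately show ?thesis using adj l(2) by blast
qed

end
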